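(* Let $\rho,\kappa>-1$ be real numbers, $m\ge0$ an integer and $n$ an integer with $n+\rho\ge0$. Then, for $z\in\mathbb{D}^*$, $$\mathcal{Z}^{\kappa,\rho}_{m,n}(z,\bar z)=(\kappa+1)_m\,z^n\bar z^m\;{}_2F_1\Big(-m,\,-n-\rho;\ \kappa+1;\ 1-\frac1{|z|^2}\Big).$$
   Context: Let $\mathbb{D}=\{z\in\mathbb{C}:|z|<1\}$ and $\mathbb{D}^*=\mathbb{D}\setminus\{0\}$; $\partial/\partial z$ is the Wirtinger derivative and $(a)_n=a(a+1)\cdots(a+n-1)$. For reals $\rho,\kappa>-1$ and integers $m\ge0$, $n$ with $n+\rho\ge0$, the fractional Zernike function on $\mathbb{D}^*$ is $$\mathcal{Z}^{\kappa,\rho}_{m,n}(z,\bar z)=(-1)^m z^{-\rho}(1-|z|^2)^{-\kappa}\frac{\partial^m}{\partial z^m}\Big(z^{n+\rho}(1-|z|^2)^{\kappa+m}\Big),$$ the powers $z^{-\rho}$ and $z^{n+\rho}$ being taken with the same local branch (the result does not depend on the choice). ${}_2F_1(a,b;c;x)=\sum_{j\ge0}\frac{(a)_j(b)_j}{(c)_j}\frac{x^j}{j!}$ is the Gauss hypergeometric function; when $a=-m$ it is a terminating sum, hence a polynomial in $x$ defined for all $x$. *)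

theory Defs
  imports "HOL-Analysis.Analysis"
begin

text \<open>The Wirtinger derivative \<open>(f\<^sub>x - \<i> f\<^sub>y) / 2\<close>, with \<open>f\<^sub>x\<close> and \<open>f\<^sub>y\<close> the real partial derivatives.\<close>

definition wirtinger :: "(complex \<Rightarrow> complex) \<Rightarrow> complex \<Rightarrow> complex" where
  "wirtinger f z =
     (vector_derivative (\<lambda>t. f (z + of_real t)) (at 0)
      - \<i> * vector_derivative (\<lambda>t. f (z + \<i> * of_real t)) (at 0)) / 2"

definition log_branch :: "complex set \<Rightarrow> (complex \<Rightarrow> complex) \<Rightarrow> bool" where
  "log_branch U L \<longleftrightarrow> open U \<and> continuous_on U L \<and> (\<forall>w\<in>U. exp (L w) = w)"

lemma log_branch_exists:
  assumes "z \<noteq> 0"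
  shows "\<exists>U L. log_branch U L \<and> z \<in> U"
proof -
  define L where "L = (\<lambda>w. Ln (w / z) + Ln z)"
  define U where "U = (\<lambda>w. w / z) -` (- \<real>\<^sub>\<le>\<^sub>0)"
  have "open U"
    unfolding U_def using assms
    by (intro open_vimage continuous_intros) (auto simp: open_Compl)
  moreover have "continuous_on U L"
    unfolding L_def U_def using assms by (auto intro!: continuous_intros)
  moreover have "exp (L w) = w" if "w \<in> U" for w
    using that assms by (cases "w = 0") (auto simp: L_def U_def exp_add)
  moreover have "z \<in> U"
    using assms by (simp add: U_def)
  ultimately show ?thesis
    unfolding log_branch_def by blast
qed

definition branch_powr :: "(complex \<Rightarrow> complex) \<Rightarrow> complex \<Rightarrow> real \<Rightarrow> complex" where
  "branch_powr L z a = exp (of_real a * L z)"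

text \<open>The parameter \<open>L\<close> is the logarithm that fixes the local branch of both powers of \<open>z\<close>; the
  definition is meant at points of an open set on which \<open>L\<close> is a branch of the logarithm.\<close>

definition frac_zernike ::
  "(complex \<Rightarrow> complex) \<Rightarrow> real \<Rightarrow> real \<Rightarrow> nat \<Rightarrow> int \<Rightarrow> complex \<Rightarrow> complex" where
  "frac_zernike L \<kappa> \<rho> m n z =
     (-1) ^ m * branch_powr L z (- \<rho>) * of_real ((1 - (cmod z)\<^sup>2) powr (- \<kappa>))
     * (wirtinger ^^ m)
         (\<lambda>w. branch_powr L w (of_int n + \<rho>) * of_real ((1 - (cmod w)\<^sup>2) powr (\<kappa> + of_nat m))) z"

definition hyp2F1 :: "real \<Rightarrow> real \<Rightarrow> real \<Rightarrow> real \<Rightarrow> real" where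
  "hyp2F1 a b c x = eval_fps (fps_hypergeo [a, b] [c] 1) x"

lemma hyp2F1_altdef:
  "hyp2F1 a b c x =
     (\<Sum>j. pochhammer a j * pochhammer b j / pochhammer c j * x ^ j / fact j)"
  by (simp add: hyp2F1_def eval_fps_def field_simps)

end

theory Submission
  imports Defs
begin

text \<open>
  The reason for the formula is the Leibniz rule. Write \<open>s = n + \<rho>\<close> and \<open>b = \<kappa> + m\<close>. The branch
  \<open>z\<^sup>s\<close> is holomorphic, so Wirtinger differentiation lowers its exponent, up to a constant factor. In
  \<open>(1 - z cnj z)\<^sup>b\<close> the conjugate \<open>cnj z\<close> behaves as a constant, so each differentiation lowers the
  exponent and produces a factor \<open>cnj z\<close>. Hence the \<open>m\<close>-th derivative of the product is a binomial
  sum of explicit terms. Put \<open>r = |z|\<^sup>2\<close>. After multiplication by the prefactors \<open>z\<close> powr \<open>-\<rho>\<close> and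
  \<open>1 - r\<close> powr \<open>-\<kappa>\<close>, the exponents of both are integers again
  (\<open>branch_powr_mult_eq_power_int\<close>), and the term that puts \<open>k\<close> derivatives on \<open>z\<^sup>s\<close> contains
  \<open>z ^ (n - k) * cnj z ^ (m - k) * (1 - r) ^ k\<close>. Since \<open>z * cnj z = r\<close>, this is
  \<open>z ^ n * cnj z ^ m * ((1 - r) / r) ^ k\<close>, and \<open>(1 - r) / r\<close> is minus the argument \<open>1 - 1 / r\<close> of the
  hypergeometric function. The coefficients agree because the falling factorials of \<open>b\<close> are the
  quotients \<open>(\<kappa> + 1)\<^sub>m / (\<kappa> + 1)\<^sub>k\<close> (\<open>leibniz_coefficient\<close>).

  The operator \<open>wirtinger\<close> is built from total functions that return a value even where no derivative
  exists, so all calculations are done with the relation \<open>has_wirtinger_derivative\<close>, which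
  asserts real differentiability; \<open>higher_wirtinger_mult\<close> is the Leibniz rule in this form.
\<close>

section \<open>Wirtinger derivatives\<close>

text \<open>Every real-linear map of the complex plane has a unique form \<open>h \<mapsto> d h + e cnj h\<close>; for the
  differential of \<open>f\<close>, the coefficient \<open>d\<close> is the derivative with respect to \<open>z\<close> and \<open>e\<close> is the
  one with respect to \<open>cnj z\<close>.\<close>

definition has_wirtinger_derivative :: "(complex \<Rightarrow> complex) \<Rightarrow> complex \<Rightarrow> complex \<Rightarrow> bool" where
  "has_wirtinger_derivative f d z \<longleftrightarrow> (\<exists>e. (f has_derivative (\<lambda>h. d * h + e * cnj h)) (at z))"

lemma has_wirtinger_derivative_imp_wirtinger:
  assumes "has_wirtinger_derivative f d z"
  shows "wirtinger f z = d"
proof -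
  obtain e where f: "(f has_derivative (\<lambda>h. d * h + e * cnj h)) (at z)"
    using assms unfolding has_wirtinger_derivative_def by blast
  have along: "vector_derivative (\<lambda>t. f (z + u * of_real t)) (at 0) = d * u + e * cnj u" for u
  proof (rule vector_derivative_at)
    have line: "((\<lambda>t::real. z + u * of_real t) has_derivative (\<lambda>t. u * of_real t)) (at 0)"
      by (auto intro!: derivative_eq_intros)
    have "((\<lambda>t. f (z + u * of_real t)) has_derivative
            (\<lambda>t. d * (u * of_real t) + e * cnj (u * of_real t))) (at 0)"
      using has_derivative_compose[OF line, of f "\<lambda>h. d * h + e * cnj h"] f by simp
    then show "((\<lambda>t. f (z + u * of_real t)) has_vector_derivative d * u + e * cnj u) (at 0)"
      unfolding has_vector_derivative_def
      by (rule has_derivative_eq_rhs) (simp add: scaleR_conv_of_real distrib_left mult_ac)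
  qed
  have "wirtinger f z = ((d + e) - \<i> * (d * \<i> - e * \<i>)) / 2"
    using along[of 1] along[of \<i>] by (simp add: wirtinger_def)
  also have "\<dots> = d"
    by (simp add: algebra_simps)
  finally show ?thesis .
qed

lemma has_wirtinger_derivative_mult:
  assumes "has_wirtinger_derivative f d z" and "has_wirtinger_derivative g d' z"
  shows "has_wirtinger_derivative (\<lambda>w. f w * g w) (d * g z + f z * d') z"
proof -
  obtain e e' where
    "(f has_derivative (\<lambda>h. d * h + e * cnj h)) (at z)"
    "(g has_derivative (\<lambda>h. d' * h + e' * cnj h)) (at z)"
    using assms unfolding has_wirtinger_derivative_def by blast
  from has_derivative_mult[OF this]
  have "((\<lambda>w. f w * g w) has_derivative
      (\<lambda>h. (d * g z + f z * d') * h + (e * g z + f z * e') * cnj h)) (at z)"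
    by (rule has_derivative_eq_rhs) (auto simp: fun_eq_iff algebra_simps)
  then show ?thesis
    unfolding has_wirtinger_derivative_def by blast
qed

lemma has_wirtinger_derivative_sum:
  assumes "\<And>i. i \<in> I \<Longrightarrow> has_wirtinger_derivative (f i) (d i) z"
  shows "has_wirtinger_derivative (\<lambda>w. \<Sum>i\<in>I. f i w) (\<Sum>i\<in>I. d i) z"
proof -
  obtain e where e: "\<And>i. i \<in> I \<Longrightarrow> (f i has_derivative (\<lambda>h. d i * h + e i * cnj h)) (at z)"
    using assms unfolding has_wirtinger_derivative_def by metis
  have "((\<lambda>w. \<Sum>i\<in>I. f i w) has_derivative (\<lambda>h. \<Sum>i\<in>I. d i * h + e i * cnj h)) (at z)"
    by (intro has_derivative_sum e)
  then have "((\<lambda>w. \<Sum>i\<in>I. f i w) has_derivative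
      (\<lambda>h. (\<Sum>i\<in>I. d i) * h + (\<Sum>i\<in>I. e i) * cnj h)) (at z)"
    by (simp add: sum.distrib sum_distrib_right)
  then show ?thesis
    unfolding has_wirtinger_derivative_def by blast
qed

lemma has_wirtinger_derivative_holomorphic:
  assumes "(f has_field_derivative d) (at z)"
  shows "has_wirtinger_derivative f d z"
  unfolding has_wirtinger_derivative_def
  using assms by (intro exI[of _ 0]) (simp add: has_field_derivative_def)

lemma has_wirtinger_derivative_const: "has_wirtinger_derivative (\<lambda>_. c) 0 z"
  by (rule has_wirtinger_derivative_holomorphic) (auto intro!: derivative_eq_intros)

lemma has_wirtinger_derivative_cmult:
  assumes "has_wirtinger_derivative f d z"
  shows "has_wirtinger_derivative (\<lambda>w. c * f w) (c * d) z"
  using has_wirtinger_derivative_mult[OF has_wirtinger_derivative_const assms, of c] by simp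

lemma has_wirtinger_derivative_transform:
  assumes "has_wirtinger_derivative g d z" and "open S" and "z \<in> S"
    and "\<And>w. w \<in> S \<Longrightarrow> f w = g w"
  shows "has_wirtinger_derivative f d z"
proof -
  obtain e where "(g has_derivative (\<lambda>h. d * h + e * cnj h)) (at z)"
    using assms(1) unfolding has_wirtinger_derivative_def by blast
  then have "(f has_derivative (\<lambda>h. d * h + e * cnj h)) (at z)"
    using assms(2,3) by (rule has_derivative_transform_within_open) (simp add: assms(4))
  then show ?thesis
    unfolding has_wirtinger_derivative_def by blast
qed

lemma has_wirtinger_derivative_cnj_power: "has_wirtinger_derivative (\<lambda>w. cnj w ^ k) 0 z"
proof -
  have "((\<lambda>w. cnj w ^ k) has_derivative (\<lambda>h. 0 * h + (of_nat k * cnj z ^ (k - 1)) * cnj h)) (at z)"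
    by (auto intro!: derivative_eq_intros simp: fun_eq_iff)
  then show ?thesis
    unfolding has_wirtinger_derivative_def by blast
qed

text \<open>The factors enter as sequences of successive derivatives, because their closed forms are what
  the applications need and no smoothness has to be assumed separately.\<close>

theorem higher_wirtinger_mult:
  assumes "open S"
    and f: "\<And>j w. w \<in> S \<Longrightarrow> has_wirtinger_derivative (f j) (f (Suc j) w) w"
    and g: "\<And>j w. w \<in> S \<Longrightarrow> has_wirtinger_derivative (g j) (g (Suc j) w) w"
    and "z \<in> S"
  shows "(wirtinger ^^ m) (\<lambda>w. f 0 w * g 0 w) z
    = (\<Sum>k\<le>m. of_nat (m choose k) * (f k z * g (m - k) z))"
  using \<open>z \<in> S\<close>
proof (induction m arbitrary: z)
  case 0
  then show ?case by simp
next
  case (Suc m)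
  let ?D = "\<lambda>w. \<Sum>k\<le>m. of_nat (m choose k) *
      (f (Suc k) w * g (m - k) w + f k w * g (Suc (m - k)) w)"
  have "has_wirtinger_derivative (\<lambda>w. \<Sum>k\<le>m. of_nat (m choose k) * (f k w * g (m - k) w)) (?D z) z"
    by (intro has_wirtinger_derivative_sum has_wirtinger_derivative_cmult
        has_wirtinger_derivative_mult f g Suc.prems)
  then have "has_wirtinger_derivative ((wirtinger ^^ m) (\<lambda>w. f 0 w * g 0 w)) (?D z) z"
    using \<open>open S\<close> Suc.prems Suc.IH by (rule has_wirtinger_derivative_transform)
  then have "(wirtinger ^^ Suc m) (\<lambda>w. f 0 w * g 0 w) z = ?D z"
    by (simp add: has_wirtinger_derivative_imp_wirtinger)
  also have "\<dots> = (\<Sum>k\<le>m. of_nat (m choose k) * (f (Suc k) z * g (m - k) z))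
      + (\<Sum>k\<le>m. of_nat (m choose k) * (f k z * g (Suc m - k) z))"
    by (simp add: distrib_left sum.distrib Suc_diff_le)
  \<comment> \<open>The term \<open>k = Suc m\<close> has coefficient 0; including it lets both sums start at \<open>k = 0\<close>
    and run to the same end, as Pascal's rule requires.\<close>
  also have "(\<Sum>k\<le>m. of_nat (m choose k) * (f k z * g (Suc m - k) z))
      = (\<Sum>k\<le>Suc m. of_nat (m choose k) * (f k z * g (Suc m - k) z))"
    by (simp add: binomial_eq_0)
  also have "\<dots> = f 0 z * g (Suc m) z
      + (\<Sum>k\<le>m. of_nat (m choose Suc k) * (f (Suc k) z * g (m - k) z))"
    by (simp only: sum.atMost_Suc_shift) simp
  also have "(\<Sum>k\<le>m. of_nat (m choose k) * (f (Suc k) z * g (m - k) z)) + \<dots>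
      = (\<Sum>k\<le>Suc m. of_nat (Suc m choose k) * (f k z * g (Suc m - k) z))"
    by (simp only: sum.atMost_Suc_shift) (simp add: distrib_right sum.distrib)
  finally show ?case .
qed

section \<open>The two factors\<close>

text \<open>A branch of the logarithm is only required to be continuous; as a continuous right inverse of
  \<open>exp\<close>, whose derivative has no zeros, it is automatically holomorphic.\<close>

lemma log_branch_has_field_derivative:
  assumes "log_branch U L" and "w \<in> U"
  shows "(L has_field_derivative inverse w) (at w)"
proof -
  have L: "open U" "continuous_on U L" "\<And>v. v \<in> U \<Longrightarrow> exp (L v) = v"
    using assms(1) by (auto simp: log_branch_def)
  have "(exp has_field_derivative w) (at (L w))"
    using DERIV_exp[of "L w"] L(3)[OF assms(2)] by simp
  moreover have "w \<noteq> 0"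
    using L(3)[OF assms(2)] exp_not_eq_zero[of "L w"] by metis
  moreover have "isCont L w"
    using L(1,2) assms(2) by (simp add: continuous_on_eq_continuous_at)
  ultimately show ?thesis
    using L(1,3) assms(2) has_field_derivative_inverse_basic[of exp w L w U] by blast
qed

text \<open>The sign turns the falling factorial of \<open>a\<close>, which differentiation produces, into the rising
  factorial of \<open>-a\<close>.\<close>

lemma branch_powr_derivatives:
  assumes "log_branch U L" and "w \<in> U"
  shows "has_wirtinger_derivative
    (\<lambda>w. (-1) ^ j * of_real (pochhammer (- a) j) * branch_powr L w (a - of_nat j))
    ((-1) ^ Suc j * of_real (pochhammer (- a) (Suc j)) * branch_powr L w (a - of_nat (Suc j))) w"
proof (rule has_wirtinger_derivative_holomorphic)
  have w: "exp (L w) = w"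
    using assms by (simp add: log_branch_def)
  have "branch_powr L w (a - of_nat j) * inverse w = branch_powr L w (a - of_nat (Suc j))"
    unfolding branch_powr_def
    by (subst w[symmetric], subst exp_minus[symmetric], subst exp_add[symmetric])
      (simp add: algebra_simps)
  moreover have "((\<lambda>w. branch_powr L w (a - of_nat j)) has_field_derivative
      branch_powr L w (a - of_nat j) * (of_real (a - of_nat j) * inverse w)) (at w)"
    unfolding branch_powr_def
    by (rule derivative_eq_intros log_branch_has_field_derivative[OF assms] refl)+ simp
  ultimately have "((\<lambda>w. branch_powr L w (a - of_nat j)) has_field_derivative
      of_real (a - of_nat j) * branch_powr L w (a - of_nat (Suc j))) (at w)"
    by (metis mult.left_commute)
  from DERIV_cmult[OF this, of "(-1) ^ j * of_real (pochhammer (- a) j)"]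
  show "((\<lambda>w. (-1) ^ j * of_real (pochhammer (- a) j) * branch_powr L w (a - of_nat j))
    has_field_derivative
    (-1) ^ Suc j * of_real (pochhammer (- a) (Suc j)) * branch_powr L w (a - of_nat (Suc j))) (at w)"
    by (rule DERIV_cong) (simp add: pochhammer_Suc algebra_simps)
qed

lemma one_minus_norm_powr_wirtinger_derivative:
  assumes "cmod w < 1"
  shows "has_wirtinger_derivative (\<lambda>w. of_real ((1 - (cmod w)\<^sup>2) powr b))
    (- of_real b * cnj w * of_real ((1 - (cmod w)\<^sup>2) powr (b - 1))) w"
proof -
  let ?c = "b * (1 - (cmod w)\<^sup>2) powr (b - 1)"
  have pos: "1 - (cmod w)\<^sup>2 > 0"
    using assms by (simp add: power_less_one_iff)
  have inner: "((\<lambda>w. 1 - (cmod w)\<^sup>2) has_derivative (\<lambda>h. - (2 * (w \<bullet> h)))) (at w)"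
    unfolding power2_norm_eq_inner
    by (auto intro!: derivative_eq_intros simp: fun_eq_iff inner_commute)
  have outer: "((\<lambda>x. x powr b) has_derivative (\<lambda>x. ?c * x)) (at (1 - (cmod w)\<^sup>2))"
    using has_real_derivative_powr[OF pos, of b] by (simp add: has_field_derivative_def)
  have "((\<lambda>w. (1 - (cmod w)\<^sup>2) powr b) has_derivative (\<lambda>h. ?c * - (2 * (w \<bullet> h)))) (at w)"
    using has_derivative_compose[OF inner outer] .
  then have "((\<lambda>w. complex_of_real ((1 - (cmod w)\<^sup>2) powr b)) has_derivative
      (\<lambda>h. of_real (?c * - (2 * (w \<bullet> h))))) (at w)"
    by (rule has_derivative_of_real)
  \<comment> \<open>The differential of \<open>|w|\<^sup>2\<close> is \<open>h \<mapsto> 2 (w \<bullet> h) = cnj w * h + w * cnj h\<close>.\<close>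
  then have "((\<lambda>w. complex_of_real ((1 - (cmod w)\<^sup>2) powr b)) has_derivative
      (\<lambda>h. (- of_real b * cnj w * of_real ((1 - (cmod w)\<^sup>2) powr (b - 1))) * h
        + (- of_real b * w * of_real ((1 - (cmod w)\<^sup>2) powr (b - 1))) * cnj h)) (at w)"
    by (rule has_derivative_eq_rhs)
      (auto simp: fun_eq_iff complex_eq_iff inner_complex_def algebra_simps)
  then show ?thesis
    unfolding has_wirtinger_derivative_def by blast
qed

lemma one_minus_norm_powr_derivatives:
  assumes "cmod w < 1"
  shows "has_wirtinger_derivative
    (\<lambda>w. of_real (pochhammer (- b) j) * (cnj w ^ j * of_real ((1 - (cmod w)\<^sup>2) powr (b - of_nat j))))
    (of_real (pochhammer (- b) (Suc j)) *
      (cnj w ^ Suc j * of_real ((1 - (cmod w)\<^sup>2) powr (b - of_nat (Suc j))))) w"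
proof -
  have "b - of_nat j - 1 = b - of_nat (Suc j)"
    by simp
  with has_wirtinger_derivative_cmult[OF has_wirtinger_derivative_mult[OF
      has_wirtinger_derivative_cnj_power[of j w]
      one_minus_norm_powr_wirtinger_derivative[OF assms, of "b - of_nat j"]],
      of "of_real (pochhammer (- b) j)"]
  show ?thesis
    by (simp add: pochhammer_Suc algebra_simps)
qed

section \<open>Passage to the hypergeometric sum\<close>

text \<open>The quotient \<open>(-m)\<^sub>k / k!\<close> is a binomial coefficient up to sign, so it vanishes for \<open>k > m\<close>.\<close>

lemma hyp2F1_terminating:
  "hyp2F1 (- of_nat m) b c x
    = (\<Sum>k\<le>m. of_nat (m choose k) * (-1) ^ k * pochhammer b k / pochhammer c k * x ^ k)"
proof -
  have coeff: "pochhammer (- of_nat m) k / fact k = of_nat (m choose k) * (-1 :: real) ^ k" for k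
    by (simp add: binomial_gbinomial gbinomial_pochhammer)
  have "hyp2F1 (- of_nat m) b c x
      = (\<Sum>k. (pochhammer (- of_nat m) k / fact k) * pochhammer b k / pochhammer c k * x ^ k)"
    by (simp add: hyp2F1_altdef mult_ac)
  also have "\<dots> = (\<Sum>k. of_nat (m choose k) * (-1) ^ k * pochhammer b k / pochhammer c k * x ^ k)"
    by (simp only: coeff)
  also have "\<dots> = (\<Sum>k\<le>m. of_nat (m choose k) * (-1) ^ k * pochhammer b k / pochhammer c k * x ^ k)"
    by (rule suminf_finite) (auto simp: binomial_eq_0)
  finally show ?thesis .
qed

text \<open>Up to sign, the left-hand side is the falling factorial \<open>(c + m) (c + m - 1) \<dots> (c + k + 1)\<close>,
  which consists of the last \<open>m - k\<close> factors of \<open>(c + 1)\<^sub>m\<close>. The first \<open>k\<close> factors form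
  \<open>(c + 1)\<^sub>k\<close>, which becomes the lower parameter of the hypergeometric series.\<close>

lemma leibniz_coefficient:
  fixes c :: real
  assumes "c > -1" and "k \<le> m"
  shows "pochhammer (- (c + of_nat m)) (m - k)
    = (-1) ^ (m - k) * pochhammer (c + 1) m / pochhammer (c + 1) k"
proof -
  have "pochhammer (- (c + of_nat m)) (m - k)
      = (-1) ^ (m - k) * pochhammer (c + 1 + of_nat k) (m - k)"
    using assms(2) by (subst pochhammer_minus) (simp add: of_nat_diff algebra_simps)
  moreover have "pochhammer (c + 1) m = pochhammer (c + 1) k * pochhammer (c + 1 + of_nat k) (m - k)"
    using assms(2) by (rule pochhammer_product)
  moreover have "pochhammer (c + 1) k > 0"
    using assms(1) by (intro pochhammer_pos) simp
  ultimately show ?thesis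
    by simp
qed

text \<open>The contributions \<open>-a\<close> and \<open>a\<close> to the exponents cancel, and an integer power does not see the
  choice of the branch.\<close>

lemma branch_powr_mult_eq_power_int:
  assumes "log_branch U L" and "w \<in> U"
  shows "branch_powr L w (- a) * branch_powr L w (of_int n + a - of_nat k) = w powi n / w ^ k"
proof -
  have w: "exp (L w) = w"
    using assms by (simp add: log_branch_def)
  then have "w \<noteq> 0"
    by (metis exp_not_eq_zero)
  have "branch_powr L w (- a) * branch_powr L w (of_int n + a - of_nat k)
      = exp (of_int (n - int k) * L w)"
    unfolding branch_powr_def by (simp add: exp_add[symmetric] algebra_simps)
  also have "\<dots> = w powi (n - int k)"
    using exp_power_int[of "L w" "n - int k"] w by simp
  also have "\<dots> = w powi n / w ^ k"
    using \<open>w \<noteq> 0\<close> by (simp add: power_int_diff)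
  finally show ?thesis .
qed

theorem proposition3p4:
  fixes \<rho> \<kappa> :: real and m :: nat and n :: int and z :: complex
    and U :: "complex set" and L :: "complex \<Rightarrow> complex"
  assumes "\<rho> > -1" and "\<kappa> > -1"
    and "of_int n + \<rho> \<ge> 0"
    and "z \<noteq> 0" and "cmod z < 1"
    and "log_branch U L" and "z \<in> U"
  shows "frac_zernike L \<kappa> \<rho> m n z =
    of_real (pochhammer (\<kappa> + 1) m) * z powi n * cnj z ^ m
    * of_real (hyp2F1 (- of_nat m) (- of_int n - \<rho>) (\<kappa> + 1) (1 - 1 / (cmod z)\<^sup>2))"
proof -
  define s where "s = of_int n + \<rho>"
  define b where "b = \<kappa> + of_nat m"
  define r where "r = (cmod z)\<^sup>2"
  define f where "f j w = (-1) ^ j * of_real (pochhammer (- s) j) * branch_powr L w (s - of_nat j)"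
    for j w
  define g where "g j w = of_real (pochhammer (- b) j)
      * (cnj w ^ j * of_real ((1 - (cmod w)\<^sup>2) powr (b - of_nat j)))" for j w
  let ?S = "U \<inter> ball 0 1"
  have r: "0 < r" "r < 1"
    using assms(4,5) by (auto simp: r_def power_less_one_iff)
  have zr: "z * cnj z = of_real r"
    by (simp add: r_def complex_norm_square[symmetric])
  have leibniz: "(wirtinger ^^ m) (\<lambda>w. f 0 w * g 0 w) z
      = (\<Sum>k\<le>m. of_nat (m choose k) * (f k z * g (m - k) z))"
  proof (rule higher_wirtinger_mult)
    show "open ?S"
      using assms(6) by (auto simp: log_branch_def)
    show "has_wirtinger_derivative (f j) (f (Suc j) w) w" if "w \<in> ?S" for j w
      using branch_powr_derivatives[OF assms(6), where w = w and a = s and j = j] that unfolding f_def by simp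
    show "has_wirtinger_derivative (g j) (g (Suc j) w) w" if "w \<in> ?S" for j w
      using one_minus_norm_powr_derivatives[where w = w and b = b and j = j] that unfolding g_def by simp
    show "z \<in> ?S"
      using assms by simp
  qed
  have term_eq: "(-1) ^ m * branch_powr L z (- \<rho>) * of_real ((1 - r) powr (- \<kappa>))
        * (of_nat (m choose k) * (f k z * g (m - k) z))
      = of_real (pochhammer (\<kappa> + 1) m) * z powi n * cnj z ^ m
        * of_real (of_nat (m choose k) * (-1) ^ k * pochhammer (- s) k / pochhammer (\<kappa> + 1) k
            * (1 - 1 / r) ^ k)" (is "?lhs = ?rhs") if "k \<le> m" for k
  proof -
    have powr_eq: "(1 - r) powr (- \<kappa>) * (1 - r) powr (b - of_nat (m - k)) = (1 - r) ^ k"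
      using r that by (simp add: b_def of_nat_diff powr_add[symmetric] powr_realpow)
    have cnj_eq: "cnj z ^ (m - k) = cnj z ^ m / cnj z ^ k"
      using assms(4) that by (simp add: power_diff)
    have x_eq: "(1 - 1 / r) ^ k = (-1) ^ k * (1 - r) ^ k / r ^ k"
    proof -
      have "1 - 1 / r = (-1) * (1 - r) / r"
        using r by (simp add: field_simps)
      then show ?thesis
        by (simp only: power_mult_distrib power_divide)
    qed
    have zr_pow: "z ^ k * cnj z ^ k = of_real (r ^ k)"
      by (metis power_mult_distrib zr of_real_power)
    \<comment> \<open>The signs come from the definition of the Zernike function, from the derivatives of the power
      of \<open>z\<close> and from \<open>leibniz_coefficient\<close>.\<close>
    have sign: "(-1) ^ m * (-1) ^ k * (-1) ^ (m - k) = (1::complex)"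
      using that by (simp add: minus_one_power_iff)
    have "?lhs = of_nat (m choose k) * of_real (pochhammer (- s) k)
        * ((-1) ^ m * (-1) ^ k) * of_real (pochhammer (- b) (m - k))
        * (branch_powr L z (- \<rho>) * branch_powr L z (s - of_nat k))
        * cnj z ^ (m - k)
        * of_real ((1 - r) powr (- \<kappa>) * (1 - r) powr (b - of_nat (m - k)))"
      unfolding f_def g_def r_def[symmetric] of_real_mult by (simp only: mult_ac)
    also have "\<dots> = of_nat (m choose k) * of_real (pochhammer (- s) k)
        * ((-1) ^ m * (-1) ^ k * (-1) ^ (m - k))
        * of_real (pochhammer (\<kappa> + 1) m / pochhammer (\<kappa> + 1) k)
        * z powi n * cnj z ^ m / (z ^ k * cnj z ^ k) * of_real ((1 - r) ^ k)"
      unfolding powr_eq cnj_eq s_def branch_powr_mult_eq_power_int[OF assms(6,7)]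
      unfolding b_def leibniz_coefficient[OF assms(2) that]
      by (simp add: mult_ac)
    also have "\<dots> = ?rhs"
      unfolding sign zr_pow x_eq by (simp add: minus_one_power_iff)
    finally show ?thesis .
  qed
  have "frac_zernike L \<kappa> \<rho> m n z
      = (-1) ^ m * branch_powr L z (- \<rho>) * of_real ((1 - r) powr (- \<kappa>))
        * (wirtinger ^^ m) (\<lambda>w. f 0 w * g 0 w) z"
    by (simp add: frac_zernike_def f_def g_def s_def b_def r_def)
  also have "\<dots> = (\<Sum>k\<le>m. (-1) ^ m * branch_powr L z (- \<rho>) * of_real ((1 - r) powr (- \<kappa>))
        * (of_nat (m choose k) * (f k z * g (m - k) z)))"
    unfolding leibniz by (rule sum_distrib_left)
  also have "\<dots> = (\<Sum>k\<le>m. of_real (pochhammer (\<kappa> + 1) m) * z powi n * cnj z ^ m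
        * of_real (of_nat (m choose k) * (-1) ^ k * pochhammer (- s) k / pochhammer (\<kappa> + 1) k
            * (1 - 1 / r) ^ k))"
    by (rule sum.cong[OF refl]) (rule term_eq, simp)
  also have "\<dots> = of_real (pochhammer (\<kappa> + 1) m) * z powi n * cnj z ^ m
      * of_real (hyp2F1 (- of_nat m) (- s) (\<kappa> + 1) (1 - 1 / r))"
    unfolding hyp2F1_terminating of_real_sum by (rule sum_distrib_left[symmetric])
  finally show ?thesis
    by (simp add: s_def r_def)
qed

end
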